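(* Let $(T,+)$ be a commutative Hausdorff semitopological semigroup and let $S$ be a dense subsemigroup of $T$. Let $\mathcal{B}$ be a countable local base with the $\mathbf{F}$ property at the point $e\in E(T)$. Let $\vec{a}=\langle a_0,a_1,\dots,a_l\rangle$ be a compressed sequence in $\mathbb{N}$ with $l>0$, let $C$ be a Milliken–Taylor matrix for $\vec{a}$, and for each $t<\omega$ let $B_t$ be a $u_t\times v_t$ finite matrix with entries from $\omega$ which is image partition regular over $\mathbb{N}$. Then any insertion matrix of $\langle B_t\rangle_{t<\omega}$ into $C$ is image partition regular over $S$ near $e$ ($IPR/S_e$).
   Context: $\omega=\{0,1,2,\dots\}$, $\mathbb{N}=\{1,2,\dots\}$. A semitopological semigroup is a semigroup with a topology for which the operation is separately continuous. $E(T)=\{e\in T: e+e=e\}$. For $x\in T$, $\tau_x$ is the collection of all sets $U\subseteq T$ with $x\in \mathrm{int}_T(U)$. $\mathbf{F}$ property: for a sequence, $FS(\langle x_n\rangle_{n=k}^{l})$ is the set of all $\sum_{n\in F}x_n$ with $F$ a nonempty subset of $\{k,\dots,l\}$; $\sum_{n=1}^\infty x_n$ converges near $e$ if for each $U\in\tau_e$ there is $m\in\mathbb{N}$ such that $FS(\langle x_n\rangle_{n=k}^{l})\subseteq U$ for all $l>k\ge m$. A countable local base $\mathcal{B}=\{U_n:n\in\mathbb{N}\}$ at $e$ has the $\mathbf{F}$ property at $e$ if (i) $\{V\in\mathcal{B}: y\in V\}$ is finite for each $y\in T\setminus\{e\}$; (ii) $U_{n+1}\subseteq U_n$ and $U_{n+1}+U_{n+1}\subseteq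 U_n$ for each $n$; (iii) for every sequence with $x_n\in U_n$ for all $n$, $\sum_{n=1}^\infty x_n$ converges near $e$. Image partition regularity over $\mathbb{N}$: a $u\times v$ matrix $M$ is image partition regular over $\mathbb{N}$ if whenever $r\in\mathbb{N}$ and $\mathbb{N}=\bigcup_{i=1}^rA_i$, there are $i\in\{1,\dots,r\}$ and $\vec{x}\in\mathbb{N}^v$ with $M\vec{x}\in A_i^u$. Products over $S$: for $c\in\mathbb{N}$, $s\in S$, $cs=s+\dots+s$ ($c$ times). For a nonzero row with entries in $\omega$, finitely many nonzero, the corresponding entry of $M\vec{x}$ is the sum of $m_jx_j$ over the $j$ with $m_j\ne0$. Near $e$: an $\omega\times\omega$ matrix $M$ is $IPR/S_e$ if whenever $r\in\mathbb{N}$ and $S=\bigcup_{i=1}^rA_i$, there is $i\in\{1,\dots,r\}$ such that for every $U\in\tau_e$ there exists $\vec{x}=\langle x_n\rangle_{n<\omega}\in S^\omega$ with $\lim_{n\to\infty}x_n=e$ and all entries of $M\vec{x}$ in $A_i\cap U$. Compressed sequences and Milliken–Taylor matrices: for a finite or infinite sequence $\vec{a}$ in $\omega$ with only finitely many nonzero entries, its compressed form $c(\vec{a})$ is obtained by deleting all zeros and then deleting all adjacent repeated entries; $\vec{a}$ is compressed if $\vec{a}=c(\vec{a})$. A Milliken–Taylor matrix for a compressed sequence $\vec{a}$ in $\mathbb{N}$ is an $\omega\times\omega$ matrix whose rows are all possible rows with entries in $\omega$, finitely many nonzero, having compressed form $\vec{a}$. Insertion matrices: let $\gamma,\delta\in\omega\cup\{\omega\}$,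 let $C=(c_{i,t})$ be a $\gamma\times\delta$ matrix with finitely many nonzero entries in each row, and for each $t<\delta$ let $B_t$ be a finite $u_t\times v_t$ matrix with $k$-th row $\vec{b}^{(t)}_k$, $k\in\{0,\dots,u_t-1\}$. Let $R=\{(i,j): i<\gamma,\ j\in\times_{t<\delta}\{0,1,\dots,u_t-1\}\}$. $D$ is an insertion matrix of $\langle B_t\rangle_{t<\delta}$ into $C$ iff the rows of $D$ are all rows of the form $c_{i,0}\cdot\vec{b}^{(0)}_{j(0)}\frown c_{i,1}\cdot\vec{b}^{(1)}_{j(1)}\frown\cdots$ with $(i,j)\in R$, where $\frown$ denotes concatenation (repeated rows may be listed once). *)

theory Defs
  imports "HOL-Analysis.Elementary_Topology"
begin

text \<open>
  The ambient semigroup need not have a neutral element, so finite sums are formed over nonempty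
  index sets only and the library's \<open>sum\<close> (which needs a zero) is not applicable.
  The value on the empty list is unspecified and plays no role.
\<close>

fun sg_sum_list :: "'a::ab_semigroup_add list \<Rightarrow> 'a" where
  "sg_sum_list [x] = x"
| "sg_sum_list (x # y # xs) = x + sg_sum_list (y # xs)"

definition sg_sum :: "(nat \<Rightarrow> 'a::ab_semigroup_add) \<Rightarrow> nat set \<Rightarrow> 'a" where
  "sg_sum f F = sg_sum_list (map f (sorted_list_of_set F))"

definition sg_mult :: "nat \<Rightarrow> 'a::ab_semigroup_add \<Rightarrow> 'a" where
  "sg_mult c s = sg_sum_list (replicate c s)"

text \<open>Neighbourhoods are not required to be open.\<close>

definition nbhds_at :: "'a::topological_space \<Rightarrow> 'a set set" where
  "nbhds_at x = {U. x \<in> interior U}"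

definition FS :: "(nat \<Rightarrow> 'a::ab_semigroup_add) \<Rightarrow> nat \<Rightarrow> nat \<Rightarrow> 'a set" where
  "FS x k l = {sg_sum x F | F. F \<noteq> {} \<and> F \<subseteq> {k..l}}"

definition series_converges_near ::
  "(nat \<Rightarrow> 'a::{ab_semigroup_add, topological_space}) \<Rightarrow> 'a \<Rightarrow> bool" where
  "series_converges_near x e \<longleftrightarrow>
     (\<forall>V \<in> nbhds_at e. \<exists>m\<ge>1. \<forall>k l. m \<le> k \<and> k < l \<longrightarrow> FS x k l \<subseteq> V)"

text \<open>
  A countable local base is given by its enumeration \<open>U 1, U 2, \<dots>\<close>, possibly with repetitions;
  the base as a collection of sets is \<open>U ` {1..}\<close>, and \<open>U 0\<close> is ignored.
\<close>

definition countable_local_base :: "(nat \<Rightarrow> 'a::topological_space set) \<Rightarrow> 'a \<Rightarrow> bool" where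
  "countable_local_base U e \<longleftrightarrow>
     U ` {1..} \<subseteq> nbhds_at e \<and> (\<forall>V \<in> nbhds_at e. \<exists>W \<in> U ` {1..}. W \<subseteq> V)"

definition F_property ::
  "(nat \<Rightarrow> 'a::{ab_semigroup_add, topological_space} set) \<Rightarrow> 'a \<Rightarrow> bool" where
  "F_property U e \<longleftrightarrow>
     (\<forall>y. y \<noteq> e \<longrightarrow> finite {V \<in> U ` {1..}. y \<in> V}) \<and>
     (\<forall>n\<ge>1. U (n + 1) \<subseteq> U n \<and> (\<forall>x \<in> U (n + 1). \<forall>y \<in> U (n + 1). x + y \<in> U n)) \<and>
     (\<forall>x. (\<forall>n\<ge>1. x n \<in> U n) \<longrightarrow> series_converges_near x e)"

text \<open>
  Matrices are functions of a row and a column index, both counted from \<open>0\<close>; the dimensions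
  \<open>u\<close>, \<open>v\<close> of a finite matrix are passed separately and values outside them are ignored.
  The positive integers are the set \<open>{1..}\<close> of type \<open>nat set\<close>.
\<close>

definition ipr_nat :: "nat \<Rightarrow> nat \<Rightarrow> (nat \<Rightarrow> nat \<Rightarrow> nat) \<Rightarrow> bool" where
  "ipr_nat u v M \<longleftrightarrow>
     (\<forall>r\<ge>1. \<forall>A :: nat \<Rightarrow> nat set. {1..} = (\<Union>i\<in>{1..r}. A i) \<longrightarrow>
       (\<exists>i\<in>{1..r}. \<exists>x. (\<forall>j<v. x j \<in> {1..}) \<and> (\<forall>k<u. (\<Sum>j<v. M k j * x j) \<in> A i)))"

definition matrix_entry ::
  "(nat \<Rightarrow> nat \<Rightarrow> nat) \<Rightarrow> (nat \<Rightarrow> 'a::ab_semigroup_add) \<Rightarrow> nat \<Rightarrow> 'a" where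
  "matrix_entry M x k = sg_sum (\<lambda>j. sg_mult (M k j) (x j)) {j. M k j \<noteq> 0}"

definition ipr_near ::
  "'a::{ab_semigroup_add, topological_space} set \<Rightarrow> 'a \<Rightarrow> (nat \<Rightarrow> nat \<Rightarrow> nat) \<Rightarrow> bool" where
  "ipr_near S e M \<longleftrightarrow>
     (\<forall>r\<ge>1. \<forall>A :: nat \<Rightarrow> 'a set. S = (\<Union>i\<in>{1..r}. A i) \<longrightarrow>
       (\<exists>i\<in>{1..r}. \<forall>U \<in> nbhds_at e.
         \<exists>x. (\<forall>n. x n \<in> S) \<and> x \<longlonglongrightarrow> e \<and> (\<forall>k. matrix_entry M x k \<in> A i \<inter> U)))"

definition compressed_list :: "nat list \<Rightarrow> bool" where
  "compressed_list a \<longleftrightarrow> a = remdups_adj (filter (\<lambda>c. c \<noteq> 0) a)"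

definition compressed_form :: "(nat \<Rightarrow> nat) \<Rightarrow> nat list" where
  "compressed_form r = remdups_adj (map r (sorted_list_of_set {n. r n \<noteq> 0}))"

definition milliken_taylor_matrix :: "nat list \<Rightarrow> (nat \<Rightarrow> nat \<Rightarrow> nat) \<Rightarrow> bool" where
  "milliken_taylor_matrix a C \<longleftrightarrow>
     range C = {r. finite {n. r n \<noteq> 0} \<and> compressed_form r = a}"

text \<open>
  In the concatenation \<open>c 0 \<cdot> b 0 \<frown> c 1 \<cdot> b 1 \<frown> \<dots>\<close> of vectors \<open>b t\<close> of length \<open>v t\<close>, the block
  \<open>t\<close> starts at column \<open>\<Sum>s<t. v s\<close>. For positive \<open>v t\<close> the blocks partition the columns, so that
  the condition below determines the row \<open>d\<close>.
\<close>

definition is_concat_row ::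
  "(nat \<Rightarrow> nat) \<Rightarrow> (nat \<Rightarrow> nat) \<Rightarrow> (nat \<Rightarrow> nat \<Rightarrow> nat) \<Rightarrow> (nat \<Rightarrow> nat) \<Rightarrow> bool" where
  "is_concat_row v c b d \<longleftrightarrow> (\<forall>t. \<forall>p < v t. d ((\<Sum>s<t. v s) + p) = c t * b t p)"

text \<open>
  Insertion of \<open>u t \<times> v t\<close> matrices \<open>B t\<close> into an \<open>\<omega> \<times> \<omega>\<close> matrix \<open>C\<close>. Only the set of rows is
  prescribed, so rows may be listed in any order and with any multiplicity.
\<close>

definition insertion_matrix ::
  "(nat \<Rightarrow> nat) \<Rightarrow> (nat \<Rightarrow> nat) \<Rightarrow> (nat \<Rightarrow> nat \<Rightarrow> nat \<Rightarrow> nat) \<Rightarrow>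
   (nat \<Rightarrow> nat \<Rightarrow> nat) \<Rightarrow> (nat \<Rightarrow> nat \<Rightarrow> nat) \<Rightarrow> bool" where
  "insertion_matrix u v B C D \<longleftrightarrow>
     range D = {d. \<exists>i j. (\<forall>t. j t < u t) \<and> is_concat_row v (C i) (\<lambda>t. B t (j t)) d}"

end

theory Submission
  imports Defs
begin

text \<open>
  Let \<open>N\<close> be the trace on \<open>S\<close> of the neighbourhood filter of \<open>e\<close>. The ultrafilters \<open>p \<le> N\<close> all of whose
  members contain images of all the \<open>B t\<close> with arguments arbitrarily near \<open>e\<close> form a closed
  subsemigroup of the ultrafilters on \<open>S\<close>. It is nonempty: an ultrafilter on the positive integers
  whose members contain images of \<open>B t\<close> acts on ultrafilters near \<open>e\<close> by taking multiples, which adds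
  \<open>B t\<close> to the matrices served and keeps the earlier ones; compactness does the rest. Take an
  idempotent \<open>p\<close> in it and a colour class \<open>A\<close> in \<open>a\<^sub>0 p + \<dots> + a\<^sub>l p\<close>. The blocks of variables are then
  chosen one at a time, so that each of the finitely many partial sums met so far can still be
  completed to an element of \<open>A\<close> within any neighbourhood of \<open>e\<close> fixed beforehand.
\<close>

subsection \<open>Ultrafilters and the sum of filters\<close>

text \<open>The limit of the filters \<open>f x\<close> along \<open>p\<close>. Sums and multiples
  of ultrafilters are both of this form.\<close>

definition fbind :: "'a filter \<Rightarrow> ('a \<Rightarrow> 'b filter) \<Rightarrow> 'b filter" where
  "fbind p f = Abs_filter (\<lambda>P. \<forall>\<^sub>F x in p. eventually P (f x))"

lemma eventually_fbind: "eventually P (fbind p f) \<longleftrightarrow> (\<forall>\<^sub>F x in p. eventually P (f x))"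
  unfolding fbind_def
proof (rule eventually_Abs_filter, rule is_filter.intro)
  fix P Q
  assume "\<forall>\<^sub>F x in p. eventually P (f x)" "\<forall>\<^sub>F x in p. eventually Q (f x)"
  then show "\<forall>\<^sub>F x in p. \<forall>\<^sub>F x in f x. P x \<and> Q x"
    by eventually_elim (rule eventually_conj)
next
  fix P Q
  assume "\<forall>x. P x \<longrightarrow> Q x" "\<forall>\<^sub>F x in p. eventually P (f x)"
  from this(2) show "\<forall>\<^sub>F x in p. eventually Q (f x)"
    by eventually_elim (use \<open>\<forall>x. P x \<longrightarrow> Q x\<close> in \<open>auto elim: eventually_mono\<close>)
qed simp

text \<open>Points of the Stone-Cech compactification are taken as filters, and a filter
  \<open>F\<close> stands for the closed set of ultrafilters \<open>p \<le> F\<close>. Nonemptiness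
  of a closed set is then \<open>F \<noteq> bot\<close>.\<close>

definition ultra :: "'a filter \<Rightarrow> bool" where
  "ultra p \<longleftrightarrow> p \<noteq> bot \<and> (\<forall>P. eventually P p \<or> (\<forall>\<^sub>F x in p. \<not> P x))"

lemma ultra_not_eventually:
  assumes "ultra p"
  shows "\<not> eventually P p \<longleftrightarrow> (\<forall>\<^sub>F x in p. \<not> P x)"
  using assms eventually_conj[of P p "\<lambda>x. \<not> P x"]
  by (auto simp: ultra_def trivial_limit_def)

lemma ultra_neq_bot: "ultra p \<Longrightarrow> p \<noteq> bot"
  by (simp add: ultra_def)

lemma ultra_fbind:
  assumes "ultra p" "\<And>x. ultra (f x)"
  shows "ultra (fbind p f)"
proof -
  have "\<not> (\<forall>\<^sub>F x in p. eventually (\<lambda>_. False) (f x))"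
    using assms by (simp add: ultra_def trivial_limit_def)
  moreover have "eventually P (fbind p f) \<or> (\<forall>\<^sub>F x in fbind p f. \<not> P x)" for P
  proof (cases "eventually P (fbind p f)")
    case False
    then have "\<forall>\<^sub>F x in p. \<not> eventually P (f x)"
      using ultra_not_eventually[OF assms(1)] by (simp add: eventually_fbind)
    then show ?thesis
      by (simp add: eventually_fbind ultra_not_eventually[OF assms(2)])
  qed simp
  ultimately show ?thesis
    by (simp add: ultra_def trivial_limit_def eventually_fbind)
qed

lemma ultra_filtermap: "ultra p \<Longrightarrow> ultra (filtermap f p)"
  by (auto simp: ultra_def filtermap_bot_iff eventually_filtermap)

lemma ultra_principal_singleton: "ultra (principal {x})"
  by (auto simp: ultra_def eventually_principal principal_eq_bot_iff)

lemma ultra_eventually_ex: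
  assumes "ultra p" "finite I" "\<forall>\<^sub>F x in p. \<exists>i\<in>I. P i x"
  shows "\<exists>i\<in>I. eventually (P i) p"
proof (rule ccontr)
  assume "\<not> ?thesis"
  then have "\<forall>i\<in>I. \<forall>\<^sub>F x in p. \<not> P i x"
    using ultra_not_eventually[OF assms(1)] by blast
  then have "\<forall>\<^sub>F x in p. \<forall>i\<in>I. \<not> P i x"
    using assms(2) by (simp add: eventually_ball_finite)
  with assms(3) have "\<forall>\<^sub>F x in p. False"
    by eventually_elim blast
  then show False
    using assms(1) by (simp add: ultra_def trivial_limit_def)
qed

section \<open>Zorn's lemma for filters and the existence of ultrafilters\<close>

lemma minimal_filter_exists:
  fixes Q :: "'a filter \<Rightarrow> bool"
  assumes "Q F"
    and "\<And>\<C>. \<C> \<noteq> {} \<Longrightarrow> (\<And>F. F \<in> \<C> \<Longrightarrow> Q F) \<Longrightarrow>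
      (\<And>F G. F \<in> \<C> \<Longrightarrow> G \<in> \<C> \<Longrightarrow> F \<le> G \<or> G \<le> F) \<Longrightarrow> Q (Inf \<C>)"
  obtains M where "Q M" "\<And>F. Q F \<Longrightarrow> F \<le> M \<Longrightarrow> F = M"
proof -
  have "\<exists>M\<in>Collect Q. \<forall>F\<in>Collect Q. F \<le> M \<longrightarrow> F = M"
  proof (rule predicate_Zorn[where P = "\<lambda>F G. G \<le> F"])
    show "partial_order_on (Collect Q) (relation_of (\<lambda>F G. G \<le> F) (Collect Q))"
      by (rule partial_order_on_relation_ofI) auto
  next
    fix \<C> assume "\<C> \<in> Chains (relation_of (\<lambda>F G. G \<le> F) (Collect Q))"
    then have \<C>: "\<And>F. F \<in> \<C> \<Longrightarrow> Q F" "\<And>F G. F \<in> \<C> \<Longrightarrow> G \<in> \<C> \<Longrightarrow> F \<le> G \<or> G \<le> F"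
      by (auto simp: Chains_def relation_of_def)
    show "\<exists>M\<in>Collect Q. \<forall>F\<in>\<C>. M \<le> F"
    proof (cases "\<C> = {}")
      case True
      then show ?thesis using assms(1) by auto
    next
      case False
      then have "Q (Inf \<C>)" using \<C> by (rule assms(2))
      then show ?thesis by (auto intro: Inf_lower)
    qed
  qed
  then show ?thesis using that by auto
qed

text \<open>A chain is a filter base, so whatever holds eventually in the infimum already does so in
  one member. This is how compactness enters the Zorn arguments.\<close>

lemma Inf_chain_neq_bot:
  fixes \<C> :: "'a filter set"
  assumes "\<C> \<noteq> {}" "\<And>F G. F \<in> \<C> \<Longrightarrow> G \<in> \<C> \<Longrightarrow> F \<le> G \<or> G \<le> F" "\<And>F. F \<in> \<C> \<Longrightarrow> F \<noteq> bot"
  shows "Inf \<C> \<noteq> bot"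
proof -
  have "\<exists>H\<in>\<C>. H \<le> inf F G" if "F \<in> \<C>" "G \<in> \<C>" for F G
    using assms(2)[OF that] that by (metis inf.absorb1 inf.absorb2 order_refl)
  then show ?thesis
    using assms(1,3) by (auto simp: trivial_limit_def eventually_Inf_base)
qed

lemma ultra_le_exists:
  assumes "F \<noteq> bot"
  shows "\<exists>p\<le>F. ultra p"
proof -
  obtain p where p: "p \<noteq> bot \<and> p \<le> F"
    and p_min: "\<And>q. q \<noteq> bot \<and> q \<le> F \<Longrightarrow> q \<le> p \<Longrightarrow> q = p"
  proof (rule minimal_filter_exists[of "\<lambda>p. p \<noteq> bot \<and> p \<le> F" F])
    show "F \<noteq> bot \<and> F \<le> F" using assms by simp
    fix \<C> :: "'a filter set"
    assume "\<C> \<noteq> {}" and \<C>: "\<And>G. G \<in> \<C> \<Longrightarrow> G \<noteq> bot \<and> G \<le> F"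
      and "\<And>G H. G \<in> \<C> \<Longrightarrow> H \<in> \<C> \<Longrightarrow> G \<le> H \<or> H \<le> G"
    then have "Inf \<C> \<noteq> bot"
      by (intro Inf_chain_neq_bot) auto
    moreover have "Inf \<C> \<le> F"
      using \<open>\<C> \<noteq> {}\<close> \<C> by (auto intro: Inf_lower2)
    ultimately show "Inf \<C> \<noteq> bot \<and> Inf \<C> \<le> F" ..
  qed blast
  have "eventually P p \<or> (\<forall>\<^sub>F x in p. \<not> P x)" for P
  \<comment> \<open>Adding \<open>P\<close> to the minimal filter either destroys properness or
    changes nothing.\<close>
  proof (cases "inf p (principal {x. P x}) = bot")
    case True
    then have "\<forall>\<^sub>F x in p. \<not> P x"
      by (simp add: trivial_limit_def eventually_inf_principal)
    then show ?thesis ..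
  next
    case False
    then have "inf p (principal {x. P x}) = p"
      using p by (intro p_min) (auto intro: le_infI1)
    then have "p \<le> principal {x. P x}"
      by (metis inf.cobounded2)
    then show ?thesis
      by (simp add: le_principal)
  qed
  with p show ?thesis by (auto simp: ultra_def)
qed

lemma le_ultra_eq:
  assumes "ultra p" "F \<le> p" "F \<noteq> bot"
  shows "F = p"
proof (rule antisym)
  show "p \<le> F"
  proof (rule filter_leI)
    fix P assume P: "eventually P F"
    show "eventually P p"
    proof (rule ccontr)
      assume "\<not> eventually P p"
      then have "\<forall>\<^sub>F x in F. \<not> P x"
        using assms ultra_not_eventually filter_leD by blast
      with P have "\<forall>\<^sub>F x in F. False" by eventually_elim simp
      then show False using assms(3) by (simp add: trivial_limit_def)
    qed
  qed
qed (use assms in simp)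

text \<open>If \<open>P\<close> belonged to \<open>G\<close> but not to \<open>F\<close>, an
  ultrafilter finer than \<open>F\<close> would contain the negation of \<open>P\<close>. Inclusions
  of closed sets can thus be checked on points.\<close>

lemma filter_le_if_ultra_le:
  assumes "\<And>p. ultra p \<Longrightarrow> p \<le> F \<Longrightarrow> p \<le> G"
  shows "F \<le> G"
proof (rule filter_leI, rule ccontr)
  fix P assume P: "eventually P G" and "\<not> eventually P F"
  then have "inf F (principal {x. \<not> P x}) \<noteq> bot"
    by (simp add: trivial_limit_def eventually_inf_principal)
  then obtain p where p: "p \<le> inf F (principal {x. \<not> P x})" "ultra p"
    using ultra_le_exists by blast
  then have "eventually P p" "\<forall>\<^sub>F x in p. \<not> P x"
    using assms[OF p(2)] P by (auto simp: le_principal filter_leD)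
  with p(2) show False
    using ultra_not_eventually by blast
qed

text \<open>On ultrafilters this is the sum in \<beta> with the first summand as the outer
  quantifier, so that right translation by a fixed \<open>q\<close> is continuous.\<close>

definition fadd :: "'a::plus filter \<Rightarrow> 'a filter \<Rightarrow> 'a filter" where
  "fadd p q = fbind p (\<lambda>x. filtermap ((+) x) q)"

lemma eventually_fadd:
  "eventually P (fadd p q) \<longleftrightarrow> (\<forall>\<^sub>F x in p. \<forall>\<^sub>F y in q. P (x + y))"
  by (simp add: fadd_def eventually_fbind eventually_filtermap)

lemma ultra_fadd: "ultra p \<Longrightarrow> ultra q \<Longrightarrow> ultra (fadd p q)"
  unfolding fadd_def by (intro ultra_fbind ultra_filtermap)

lemma fadd_assoc: "fadd (fadd p q) r = fadd p (fadd q (r :: 'a::semigroup_add filter))"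
  by (simp add: filter_eq_iff eventually_fadd add.assoc)

lemma fadd_mono:
  assumes "p \<le> p'" "q \<le> q'"
  shows "fadd p q \<le> fadd p' q'"
proof (rule filter_leI)
  fix P assume "eventually P (fadd p' q')"
  then have "\<forall>\<^sub>F x in p. \<forall>\<^sub>F y in q'. P (x + y)"
    using assms(1) by (simp add: eventually_fadd filter_leD)
  then show "eventually P (fadd p q)"
    unfolding eventually_fadd
    by eventually_elim (use assms(2) in \<open>auto dest: filter_leD\<close>)
qed

text \<open>The preimage of \<open>p\<close> under right translation by \<open>q\<close>: the
  coarsest filter \<open>r\<close> with \<open>fadd r q \<le> p\<close>.\<close>

definition fsub :: "'a::plus filter \<Rightarrow> 'a filter \<Rightarrow> 'a filter" where
  "fsub p q = (INF P\<in>{P. eventually P p}. principal {x. \<forall>\<^sub>F y in q. P (x + y)})"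

lemma le_fsub_iff: "r \<le> fsub p q \<longleftrightarrow> fadd r q \<le> p"
  unfolding fsub_def le_INF_iff le_principal le_filter_def[of "fadd r q"] eventually_fadd by simp

lemma eventually_fsub:
  "eventually R (fsub p q) \<longleftrightarrow>
    (\<exists>P. eventually P p \<and> (\<forall>x. (\<forall>\<^sub>F y in q. P (x + y)) \<longrightarrow> R x))"
  unfolding fsub_def
proof (subst eventually_INF_base)
  fix P Q assume "P \<in> {P. eventually P p}" "Q \<in> {P. eventually P p}"
  then show "\<exists>x\<in>{P. eventually P p}. principal {xa. \<forall>\<^sub>F y in q. x (xa + y)}
      \<le> inf (principal {x. \<forall>\<^sub>F y in q. P (x + y)}) (principal {x. \<forall>\<^sub>F y in q. Q (x + y)})"
    by (intro bexI[of _ "\<lambda>x. P x \<and> Q x"]) (auto simp: eventually_conj_iff)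
next
  show "{P. eventually P p} \<noteq> {}"
    using eventually_True by blast
qed (auto simp: eventually_principal)

text \<open>Continuous images of compact sets are closed. Were \<open>F\<close> incompatible with
  the preimage \<open>fsub p q\<close>, some member of \<open>p\<close> would have its complement in
  \<open>fadd F q\<close>, although \<open>p\<close> refines that filter.\<close>

lemma ultra_le_fadd_lift:
  fixes F :: "'a::plus filter"
  assumes "ultra p" "ultra q" "p \<le> fadd F q"
  shows "\<exists>r\<le>F. ultra r \<and> fadd r q = p"
proof -
  have "inf F (fsub p q) \<noteq> bot"
  proof
    assume "inf F (fsub p q) = bot"
    then obtain A R where AR: "eventually A F" "eventually R (fsub p q)" "\<And>x. \<not> (A x \<and> R x)"
      unfolding trivial_limit_def eventually_inf by blast
    then obtain P where P: "eventually P p" "\<And>x. (\<forall>\<^sub>F y in q. P (x + y)) \<Longrightarrow> R x"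
      unfolding eventually_fsub by blast
    have "\<forall>\<^sub>F x in F. \<not> (\<forall>\<^sub>F y in q. P (x + y))"
      using AR(1) by eventually_elim (use AR(3) P(2) in blast)
    then have "\<forall>\<^sub>F x in fadd F q. \<not> P x"
      by (simp add: eventually_fadd ultra_not_eventually[OF assms(2)])
    then show False
      using assms P(1) ultra_not_eventually filter_leD by blast
  qed
  then obtain r where "r \<le> inf F (fsub p q)" "ultra r"
    using ultra_le_exists by blast
  then show ?thesis
    using le_ultra_eq[OF assms(1), of "fadd r q"] ultra_fadd[OF _ assms(2)] ultra_neq_bot
    by (auto simp: le_fsub_iff)
qed

text \<open>The Ellis--Numakura lemma for the closed subsemigroup of the \<open>\<beta>\<close>-compactification that
  consists of the ultrafilters finer than \<open>F\<close>.\<close>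

lemma idempotent_ultrafilter_exists:
  fixes F :: "'a::semigroup_add filter"
  assumes "F \<noteq> bot"
    and "\<And>p q. ultra p \<Longrightarrow> ultra q \<Longrightarrow> p \<le> F \<Longrightarrow> q \<le> F \<Longrightarrow> fadd p q \<le> F"
  shows "\<exists>p\<le>F. ultra p \<and> fadd p p = p"
proof -
  let ?K = "\<lambda>G. G \<noteq> bot \<and> G \<le> F \<and>
    (\<forall>p q. ultra p \<longrightarrow> ultra q \<longrightarrow> p \<le> G \<longrightarrow> q \<le> G \<longrightarrow> fadd p q \<le> G)"
  obtain M where K: "?K M" and K_min: "\<And>G. ?K G \<Longrightarrow> G \<le> M \<Longrightarrow> G = M"
  proof (rule minimal_filter_exists[of ?K F])
    show "?K F" using assms by blast
    fix \<C> :: "'a filter set"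
    assume ne: "\<C> \<noteq> {}" and \<C>: "\<And>G. G \<in> \<C> \<Longrightarrow> ?K G"
      and chain: "\<And>G H. G \<in> \<C> \<Longrightarrow> H \<in> \<C> \<Longrightarrow> G \<le> H \<or> H \<le> G"
    have "Inf \<C> \<noteq> bot"
      using ne chain \<C> by (intro Inf_chain_neq_bot) auto
    moreover have "Inf \<C> \<le> F"
      using ne \<C> by (auto intro: Inf_lower2)
    moreover have "fadd p q \<le> Inf \<C>" if "ultra p" "ultra q" "p \<le> Inf \<C>" "q \<le> Inf \<C>" for p q
      using \<C> that by (simp add: le_Inf_iff)
    ultimately show "?K (Inf \<C>)" by blast
  qed blast
  have M: "M \<noteq> bot" "M \<le> F"
      "\<And>p q. ultra p \<Longrightarrow> ultra q \<Longrightarrow> p \<le> M \<Longrightarrow> q \<le> M \<Longrightarrow> fadd p q \<le> M"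
    using K by simp_all
  have M_min: "G = M" if "G \<noteq> bot" "G \<le> M"
    "\<And>p q. ultra p \<Longrightarrow> ultra q \<Longrightarrow> p \<le> G \<Longrightarrow> q \<le> G \<Longrightarrow> fadd p q \<le> G" for G
    using that order_trans[OF that(2) M(2)] by (intro K_min) simp_all
  obtain q where q: "q \<le> M" "ultra q"
    using ultra_le_exists[OF M(1)] by blast
  \<comment> \<open>Ellis's first step: \<open>fadd M q\<close> is again a closed subsemigroup
    inside \<open>M\<close>, hence equals \<open>M\<close>, and so \<open>q\<close> itself has the
    form \<open>fadd r q\<close>.\<close>
  have fadd_M: "fadd M q = M"
  proof (rule M_min)
    show "fadd M q \<noteq> bot"
      using M(1) ultra_neq_bot[OF q(2)] by (simp add: trivial_limit_def eventually_fadd)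
    show "fadd M q \<le> M"
    proof (rule filter_le_if_ultra_le)
      fix p assume "ultra p" "p \<le> fadd M q"
      then obtain r where "r \<le> M" "ultra r" "fadd r q = p"
        using ultra_le_fadd_lift q(2) by blast
      then show "p \<le> M" using M(3) q by blast
    qed
    fix p1 p2 assume p: "ultra p1" "ultra p2" "p1 \<le> fadd M q" "p2 \<le> fadd M q"
    then obtain r1 r2 where r: "r1 \<le> M" "ultra r1" "fadd r1 q = p1" "r2 \<le> M" "ultra r2" "fadd r2 q = p2"
      using ultra_le_fadd_lift q(2) by metis
    have "fadd (fadd (fadd r1 q) r2) q \<le> fadd M q"
      by (intro fadd_mono M(3) ultra_fadd r q order_refl)
    then show "fadd p1 p2 \<le> fadd M q"
      using r by (simp add: fadd_assoc)
  qed
  then obtain r where r: "r \<le> M" "ultra r" "fadd r q = q"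
    using ultra_le_fadd_lift[of q q M] q by auto
  \<comment> \<open>Ellis's second step: the ultrafilters \<open>p \<le> M\<close> with
    \<open>fadd p q = q\<close> form a nonempty closed subsemigroup, so minimality puts
    \<open>q\<close> among them.\<close>
  have "inf M (fsub q q) = M"
  proof (rule M_min)
    have "r \<le> inf M (fsub q q)"
      using r by (simp add: le_fsub_iff)
    then show "inf M (fsub q q) \<noteq> bot"
      using r(2) ultra_neq_bot bot_unique by metis
    fix p1 p2 assume p: "ultra p1" "ultra p2" "p1 \<le> inf M (fsub q q)" "p2 \<le> inf M (fsub q q)"
    then have "fadd p1 (fadd p2 q) \<le> fadd p1 q"
      by (intro fadd_mono) (auto simp: le_fsub_iff)
    also have "\<dots> \<le> q"
      using p by (simp add: le_fsub_iff)
    finally show "fadd p1 p2 \<le> inf M (fsub q q)"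
      using p M(3) by (simp add: le_fsub_iff fadd_assoc)
  qed simp
  then have "fadd q q \<le> q"
    using q(1) by (metis le_fsub_iff le_inf_iff)
  then have "fadd q q = q"
    using le_ultra_eq q(2) ultra_fadd ultra_neq_bot by metis
  with q M(2) show ?thesis by (meson order_trans)
qed

subsection \<open>Ultrafilters whose members contain images of matrices\<close>

text \<open>Written as a constant sum, so that distributivity over sums is an exchange of
  summations. It serves both the integers and the semigroup with a neutral element adjoined.\<close>

definition nmult :: "nat \<Rightarrow> 'a::comm_monoid_add \<Rightarrow> 'a" where
  "nmult n x = (\<Sum>i<n. x)"

lemma nmult_0 [simp]: "nmult 0 x = 0"
  and nmult_Suc: "nmult (Suc n) x = x + nmult n x"
  by (simp_all add: nmult_def add.commute)

lemma nmult_add: "nmult n (x + y) = nmult n x + nmult n y"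
  by (simp add: nmult_def sum.distrib)

lemma nmult_add_left: "nmult (m + n) x = nmult m x + nmult n x"
  by (induction m) (simp_all add: nmult_Suc add.assoc)

lemma nmult_mult: "nmult (m * n) x = nmult m (nmult n x)"
  by (induction m) (simp_all add: nmult_Suc nmult_add_left)

lemma nmult_sum: "nmult n (\<Sum>i\<in>I. f i) = (\<Sum>i\<in>I. nmult n (f i))"
  unfolding nmult_def by (rule sum.swap)

lemma nmult_sum_left:
  assumes "finite I"
  shows "nmult (\<Sum>i\<in>I. g i) x = (\<Sum>i\<in>I. nmult (g i) x)"
  using assms by (induction I) (simp_all add: nmult_add_left)

lemma nmult_nat: "nmult m (n :: nat) = m * n"
  by (induction m) (simp_all add: nmult_Suc)

definition row_value :: "nat \<Rightarrow> (nat \<Rightarrow> nat) \<Rightarrow> (nat \<Rightarrow> 'a::comm_monoid_add) \<Rightarrow> 'a" where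
  "row_value v b x = (\<Sum>p<v. nmult (b p) (x p))"

lemma row_value_add: "row_value v b (\<lambda>p. x p + y p) = row_value v b x + row_value v b y"
  by (simp add: row_value_def nmult_add sum.distrib)

lemma nmult_row_value: "nmult n (row_value v b x) = row_value v b (\<lambda>p. nmult n (x p))"
  by (simp add: row_value_def nmult_sum mult.commute flip: nmult_mult)

lemma row_value_nmult:
  "row_value v b (\<lambda>p. nmult (x p) s) = nmult (row_value v b x) s"
  by (simp add: row_value_def nmult_sum_left nmult_nat nmult_mult)

definition has_image ::
  "nat \<Rightarrow> nat \<Rightarrow> (nat \<Rightarrow> nat \<Rightarrow> nat) \<Rightarrow> 'a::comm_monoid_add set \<Rightarrow> 'a set \<Rightarrow> bool" where
  "has_image u v M R A \<longleftrightarrow> (\<exists>x. (\<forall>p<v. x p \<in> R) \<and> (\<forall>k<u. row_value v (M k) x \<in> A))"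

text \<open>\<open>N\<close> says where the variables lie and \<open>p\<close> where the values lie.
  The same notion is used over the positive integers, with \<open>N = principal {1..}\<close>, and
  near \<open>e\<close>.\<close>

definition rich ::
  "'a::comm_monoid_add filter \<Rightarrow> nat \<Rightarrow> nat \<Rightarrow> (nat \<Rightarrow> nat \<Rightarrow> nat) \<Rightarrow> 'a filter \<Rightarrow> bool" where
  "rich N u v M p \<longleftrightarrow>
    (\<forall>A R. (\<forall>\<^sub>F x in p. x \<in> A) \<longrightarrow> (\<forall>\<^sub>F x in N. x \<in> R) \<longrightarrow> has_image u v M R A)"

lemma richD:
  assumes "rich N u v M p" "\<forall>\<^sub>F x in p. P x" "\<forall>\<^sub>F x in N. Q x"
  shows "\<exists>x. (\<forall>p<v. Q (x p)) \<and> (\<forall>k<u. P (row_value v (M k) x))"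
  using assms(1)[unfolded rich_def, rule_format, of "Collect P" "Collect Q"] assms(2,3)
  by (simp add: has_image_def)

text \<open>Being rich means omitting every set \<open>A\<close> for which some \<open>R\<close> in
  \<open>N\<close> admits no image. Each omission is a closed condition, so the infimum encodes the
  closed set of rich ultrafilters.\<close>

definition rich_filter ::
  "'a::comm_monoid_add filter \<Rightarrow> nat \<Rightarrow> nat \<Rightarrow> (nat \<Rightarrow> nat \<Rightarrow> nat) \<Rightarrow> 'a filter" where
  "rich_filter N u v M =
    (INF A\<in>{A. \<exists>R. (\<forall>\<^sub>F x in N. x \<in> R) \<and> \<not> has_image u v M R A}. principal (- A))"

lemma le_rich_filter_iff:
  assumes "ultra p"
  shows "p \<le> rich_filter N u v M \<longleftrightarrow> rich N u v M p"
proof -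
  have "p \<le> principal (- A) \<longleftrightarrow> \<not> (\<forall>\<^sub>F x in p. x \<in> A)" for A
    by (simp add: le_principal ultra_not_eventually[OF assms])
  then show ?thesis
    by (auto simp: rich_filter_def le_INF_iff rich_def)
qed

text \<open>Compactness as a finite intersection property: a member of an infimum already belongs to
  the infimum of finitely many of the filters.\<close>

lemma inf_INF_neq_bot:
  fixes F :: "'a filter"
  assumes "\<And>J. finite J \<Longrightarrow> J \<subseteq> I \<Longrightarrow> inf F (INF t\<in>J. G t) \<noteq> bot"
  shows "inf F (INF t\<in>I. G t) \<noteq> bot"
proof
  assume "inf F (INF t\<in>I. G t) = bot"
  then obtain Q R where QR: "eventually Q F" "eventually R (INF t\<in>I. G t)" "\<And>x. \<not> (Q x \<and> R x)"
    unfolding trivial_limit_def eventually_inf by blast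
  obtain J where J: "finite J" "J \<subseteq> I" "eventually R (INF t\<in>J. G t)"
    using eventually_INF[THEN iffD1, OF QR(2)] by blast
  have "inf F (INF t\<in>J. G t) = bot"
    unfolding trivial_limit_def eventually_inf using QR(1,3) J(3) by blast
  then show False using assms J by blast
qed

text \<open>Finitely many sets without images cannot cover the positive integers, since they would
  be a colouring that violates image partition regularity. Compactness then gives an ultrafilter
  omitting all such sets.\<close>

lemma rich_ultrafilter_nat_exists:
  assumes "ipr_nat u v M"
  shows "\<exists>p\<le>principal {1::nat..}. ultra p \<and> rich (principal {1::nat..}) u v M p"
proof -
  have "inf (principal {1::nat..}) (rich_filter (principal {1::nat..}) u v M) \<noteq> bot"
    unfolding rich_filter_def
  proof (rule inf_INF_neq_bot)
    fix X :: "nat set set" assume X: "finite X"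
      "X \<subseteq> {A. \<exists>R. (\<forall>\<^sub>F x in principal {1::nat..}. x \<in> R) \<and> \<not> has_image u v M R A}"
    show "inf (principal {1::nat..}) (INF A\<in>X. principal (- A)) \<noteq> bot"
    proof
      assume "inf (principal {1::nat..}) (INF A\<in>X. principal (- A)) = bot"
      then have cover: "{1..} \<subseteq> \<Union>X"
        unfolding INF_principal_finite[OF X(1)] inf_principal principal_eq_bot_iff by blast
      moreover have "(1::nat) \<in> {1..}" by simp
      ultimately have "X \<noteq> {}" by blast
      then have "card X \<ge> 1" using X(1) by (simp add: Suc_leI card_gt_0_iff)
      obtain f where f: "bij_betw f {1..card X} X"
        using ex_bij_betw_nat_finite_1[OF X(1)] by blast
      \<comment> \<open>The sets are cut down to the positive integers because the colour classes
        must have union exactly \<open>{1..}\<close>.\<close>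
      have "{1..} = (\<Union>i\<in>{1..card X}. f i \<inter> {1..})"
        using cover bij_betw_imp_surj_on[OF f] by blast
      then obtain i x where i: "i \<in> {1..card X}" "\<forall>j<v. x j \<in> {1..}"
        "\<forall>k<u. (\<Sum>j<v. M k j * x j) \<in> f i \<inter> {1..}"
        using assms \<open>card X \<ge> 1\<close> unfolding ipr_nat_def by meson
      then have "has_image u v M R (f i)" if "\<forall>\<^sub>F x in principal {1::nat..}. x \<in> R" for R
        unfolding has_image_def row_value_def nmult_nat
        using that by (intro exI[of _ x]) (auto simp: eventually_principal)
      moreover have "f i \<in> X" using f i(1) bij_betwE by blast
      ultimately show False using X(2) by blast
    qed
  qed
  then obtain p where p: "p \<le> inf (principal {1::nat..}) (rich_filter (principal {1::nat..}) u v M)" "ultra p"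
    using ultra_le_exists by blast
  have "rich (principal {1::nat..}) u v M p"
    using p(1) le_rich_filter_iff[OF p(2)] by (meson le_inf_iff)
  with p show ?thesis
    by (meson le_inf_iff)
qed

section \<open>Ultrafilters below \<open>N\<close> under sums and multiples\<close>

lemma filterlim_nmult:
  assumes "filterlim (\<lambda>(x, y). x + y) N (N \<times>\<^sub>F N)" "n \<ge> 1"
  shows "filterlim (nmult n) N N"
  using assms(2)
proof (induction n rule: nat_induct_at_least)
  case base
  then show ?case by (simp add: nmult_Suc[abs_def] filterlim_ident)
next
  case (Suc n)
  have "filterlim (\<lambda>x. (x, nmult n x)) (N \<times>\<^sub>F N) N"
    using filterlim_ident Suc.IH by (rule filterlim_Pair)
  from filterlim_compose[OF assms(1) this] show ?case
    by (simp add: nmult_Suc[abs_def])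
qed

lemma fadd_le:
  assumes "filterlim (\<lambda>(x, y). x + y) N (N \<times>\<^sub>F N)" "p \<le> N" "q \<le> N"
  shows "fadd p q \<le> N"
proof (rule filter_leI)
  fix P assume "eventually P N"
  then have "\<forall>\<^sub>F z in N \<times>\<^sub>F N. P (fst z + snd z)"
    using eventually_compose_filterlim[OF \<open>eventually P N\<close> assms(1)] by (simp add: case_prod_beta)
  then obtain Q R where QR: "eventually Q N" "eventually R N" "\<And>x y. Q x \<Longrightarrow> R y \<Longrightarrow> P (x + y)"
    by (auto simp: eventually_prod_filter)
  then have "eventually Q p" "eventually R q"
    using assms(2,3) filter_leD by blast+
  show "eventually P (fadd p q)"
    unfolding eventually_fadd using \<open>eventually Q p\<close>
  proof eventually_elim
    case (elim x)
    show ?case using \<open>eventually R q\<close> by eventually_elim (rule QR(3)[OF elim])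
  qed
qed

text \<open>Row values are additive, so two images add up to an image. The vector \<open>x\<close>
  is chosen first; as there are finitely many rows, one member of \<open>q\<close> works for all the
  translates by its row values, and \<open>y\<close> is found for that member.\<close>

lemma rich_fadd:
  assumes N: "filterlim (\<lambda>(x, y). x + y) N (N \<times>\<^sub>F N)" and "rich N u v M p" "rich N u v M q"
  shows "rich N u v M (fadd p q)"
  unfolding rich_def
proof (intro allI impI)
  fix A R assume A: "\<forall>\<^sub>F x in fadd p q. x \<in> A" and R: "\<forall>\<^sub>F x in N. x \<in> R"
  have "\<forall>\<^sub>F z in N \<times>\<^sub>F N. fst z + snd z \<in> R"
    using eventually_compose_filterlim[OF R N] by (simp add: case_prod_beta)
  then obtain Q1 Q2 where Q: "eventually Q1 N" "eventually Q2 N"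
    "\<And>x y. Q1 x \<Longrightarrow> Q2 y \<Longrightarrow> x + y \<in> R"
    by (auto simp: eventually_prod_filter)
  obtain x where x: "\<forall>i<v. Q1 (x i)" "\<forall>k<u. \<forall>\<^sub>F z in q. row_value v (M k) x + z \<in> A"
    using richD[OF assms(2) A[unfolded eventually_fadd] Q(1)] by blast
  have "\<forall>\<^sub>F z in q. \<forall>k\<in>{..<u}. row_value v (M k) x + z \<in> A"
    using x(2) by (simp add: eventually_ball_finite)
  then obtain y where y: "\<forall>i<v. Q2 (y i)"
    "\<forall>k<u. \<forall>j<u. row_value v (M j) x + row_value v (M k) y \<in> A"
    using richD[OF assms(3) _ Q(2)] by (metis (mono_tags, lifting) lessThan_iff)
  show "has_image u v M R A"
    unfolding has_image_def
    using x y Q(3) by (intro exI[of _ "\<lambda>i. x i + y i"]) (simp add: row_value_add)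
qed

text \<open>The multiplier is the outer quantifier, so it is fixed before the element near
  \<open>e\<close> is chosen.\<close>

definition fscale :: "nat filter \<Rightarrow> 'a::comm_monoid_add filter \<Rightarrow> 'a filter" where
  "fscale p w = fbind p (\<lambda>n. filtermap (nmult n) w)"

lemma eventually_fscale:
  "eventually P (fscale p w) \<longleftrightarrow> (\<forall>\<^sub>F n in p. \<forall>\<^sub>F s in w. P (nmult n s))"
  by (simp add: fscale_def eventually_fbind eventually_filtermap)

lemma ultra_fscale: "ultra p \<Longrightarrow> ultra w \<Longrightarrow> ultra (fscale p w)"
  unfolding fscale_def by (intro ultra_fbind ultra_filtermap)

lemma fscale_le:
  assumes "\<And>n. n \<ge> 1 \<Longrightarrow> filterlim (nmult n) N N" "p \<le> principal {1::nat..}" "w \<le> N"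
  shows "fscale p w \<le> N"
proof (rule filter_leI)
  fix P assume P: "eventually P N"
  have "\<forall>\<^sub>F n in p. n \<in> {1..}" using assms(2) by (simp add: le_principal)
  then show "eventually P (fscale p w)"
    unfolding eventually_fscale
  proof eventually_elim
    case (elim n)
    then have "\<forall>\<^sub>F s in N. P (nmult n s)"
      using eventually_compose_filterlim[OF P assms(1)] by simp
    then show ?case using assms(3) filter_leD by blast
  qed
qed

text \<open>An integer image \<open>x\<close> times a single \<open>s\<close> is an image with
  arguments \<open>nmult (x i) s\<close>. The finite vector \<open>x\<close> is chosen first, so
  \<open>s\<close> can bring all these arguments into \<open>R\<close>.\<close>

lemma rich_fscale_left:
  assumes "\<And>n. n \<ge> 1 \<Longrightarrow> filterlim (nmult n) N N"
    and "rich (principal {1::nat..}) u v M p" "w \<le> N" "w \<noteq> bot"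
  shows "rich N u v M (fscale p w)"
  unfolding rich_def
proof (intro allI impI)
  fix A R assume A: "\<forall>\<^sub>F x in fscale p w. x \<in> A" and R: "\<forall>\<^sub>F x in N. x \<in> R"
  have "\<forall>\<^sub>F n in principal {1::nat..}. n \<ge> 1"
    by (simp add: eventually_principal)
  from richD[OF assms(2) A[unfolded eventually_fscale] this]
  obtain x where x: "\<forall>i<v. x i \<ge> 1" "\<forall>k<u. \<forall>\<^sub>F s in w. nmult (row_value v (M k) x) s \<in> A"
    by blast
  have "\<forall>\<^sub>F s in w. \<forall>k\<in>{..<u}. nmult (row_value v (M k) x) s \<in> A"
    using x(2) by (simp add: eventually_ball_finite)
  moreover have "\<forall>\<^sub>F s in w. \<forall>i\<in>{..<v}. nmult (x i) s \<in> R"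
  proof (intro eventually_ball_finite ballI)
    fix i assume "i \<in> {..<v}"
    then have "\<forall>\<^sub>F s in N. nmult (x i) s \<in> R"
      using eventually_compose_filterlim[OF R assms(1)] x(1) by simp
    then show "\<forall>\<^sub>F s in w. nmult (x i) s \<in> R"
      using assms(3) filter_leD by blast
  qed simp
  ultimately have "\<forall>\<^sub>F s in w. (\<forall>k\<in>{..<u}. nmult (row_value v (M k) x) s \<in> A) \<and>
      (\<forall>i\<in>{..<v}. nmult (x i) s \<in> R)"
    by (rule eventually_conj)
  then obtain s where "\<forall>k<u. nmult (row_value v (M k) x) s \<in> A" "\<forall>i<v. nmult (x i) s \<in> R"
    using eventually_happens'[OF assms(4)] by (metis (mono_tags, lifting) lessThan_iff)
  then show "has_image u v M R A"
    unfolding has_image_def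
    by (intro exI[of _ "\<lambda>i. nmult (x i) s"]) (simp add: row_value_nmult)
qed

text \<open>Rows commute with multiplication by a fixed \<open>n\<close>, so an image found for
  \<open>w\<close> is carried to one for the multiple. Its arguments reach \<open>R\<close> because
  multiplication by \<open>n \<ge> 1\<close> maps \<open>N\<close> into itself.\<close>

lemma rich_fscale_right:
  assumes "\<And>n. n \<ge> 1 \<Longrightarrow> filterlim (nmult n) N N"
    and "rich N u v M w" "p \<le> principal {1::nat..}" "p \<noteq> bot"
  shows "rich N u v M (fscale p w)"
  unfolding rich_def
proof (intro allI impI)
  fix A R assume A: "\<forall>\<^sub>F x in fscale p w. x \<in> A" and R: "\<forall>\<^sub>F x in N. x \<in> R"
  have "\<forall>\<^sub>F n in p. n \<in> {1..}" using assms(3) by (simp add: le_principal)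
  with A[unfolded eventually_fscale]
  have "\<forall>\<^sub>F n in p. (\<forall>\<^sub>F s in w. nmult n s \<in> A) \<and> n \<in> {1..}"
    by (rule eventually_conj)
  then obtain n where n: "\<forall>\<^sub>F s in w. nmult n s \<in> A" "n \<ge> 1"
    using eventually_happens'[OF assms(4)] by (metis (mono_tags, lifting) atLeast_iff)
  have "\<forall>\<^sub>F s in N. nmult n s \<in> R"
    using eventually_compose_filterlim[OF R assms(1)[OF n(2)]] .
  from richD[OF assms(2) n(1) this]
  obtain x where "\<forall>i<v. nmult n (x i) \<in> R" "\<forall>k<u. nmult n (row_value v (M k) x) \<in> A"
    by blast
  then show "has_image u v M R A"
    unfolding has_image_def
    by (intro exI[of _ "\<lambda>i. nmult n (x i)"]) (simp add: nmult_row_value)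
qed

lemma rich_ultrafilter_exists:
  fixes u v :: "nat \<Rightarrow> nat" and M :: "nat \<Rightarrow> nat \<Rightarrow> nat \<Rightarrow> nat"
  assumes N: "N \<noteq> bot" "\<And>n. n \<ge> 1 \<Longrightarrow> filterlim (nmult n) N N"
    and ipr: "\<And>t. ipr_nat (u t) (v t) (M t)"
  shows "\<exists>w\<le>N. ultra w \<and> (\<forall>t<n. rich N (u t) (v t) (M t) w)"
proof (induction n)
  case 0
  then show ?case using ultra_le_exists[OF N(1)] by auto
next
  case (Suc n)
  then obtain w where w: "w \<le> N" "ultra w" "\<forall>t<n. rich N (u t) (v t) (M t) w"
    by blast
  obtain p where p: "p \<le> principal {1::nat..}" "ultra p" "rich (principal {1::nat..}) (u n) (v n) (M n) p"
    using rich_ultrafilter_nat_exists[OF ipr] by blast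
  have "rich N (u t) (v t) (M t) (fscale p w)" if "t < Suc n" for t
  proof (cases "t = n")
    case True
    then show ?thesis
      using rich_fscale_left[OF N(2) p(3) w(1) ultra_neq_bot[OF w(2)]] by simp
  next
    case False
    then show ?thesis
      using w(3) that by (intro rich_fscale_right[OF N(2) _ p(1) ultra_neq_bot[OF p(2)]]) simp_all
  qed
  then show ?case
    using fscale_le[OF N(2) p(1) w(1)] ultra_fscale[OF p(2) w(2)] by blast
qed

lemma rich_idempotent_exists:
  fixes u v :: "nat \<Rightarrow> nat" and M :: "nat \<Rightarrow> nat \<Rightarrow> nat \<Rightarrow> nat"
  assumes N: "N \<noteq> bot" "filterlim (\<lambda>(x, y). x + y) N (N \<times>\<^sub>F N)"
    and ipr: "\<And>t. ipr_nat (u t) (v t) (M t)"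
  shows "\<exists>p\<le>N. ultra p \<and> fadd p p = p \<and> (\<forall>t. rich N (u t) (v t) (M t) p)"
proof -
  let ?F = "inf N (INF t. rich_filter N (u t) (v t) (M t))"
  have F: "p \<le> ?F \<longleftrightarrow> p \<le> N \<and> (\<forall>t. rich N (u t) (v t) (M t) p)" if "ultra p" for p
    using le_rich_filter_iff[OF that] by (simp add: le_INF_iff)
  have "?F \<noteq> bot"
  proof (rule inf_INF_neq_bot)
    fix J :: "nat set" assume "finite J"
    then obtain n where n: "J \<subseteq> {..<n}" using finite_nat_iff_bounded by blast
    obtain w where w: "w \<le> N" "ultra w" "\<forall>t<n. rich N (u t) (v t) (M t) w"
      using rich_ultrafilter_exists[where N = N and u = u and v = v and M = M and n = n,
          OF N(1) filterlim_nmult[OF N(2)] ipr] by auto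
    then have "w \<le> inf N (INF t\<in>J. rich_filter N (u t) (v t) (M t))"
      using n by (auto simp: le_INF_iff le_rich_filter_iff)
    then show "inf N (INF t\<in>J. rich_filter N (u t) (v t) (M t)) \<noteq> bot"
      using w(2) ultra_neq_bot bot_unique by metis
  qed
  moreover have "fadd p q \<le> ?F" if "ultra p" "ultra q" "p \<le> ?F" "q \<le> ?F" for p q
    unfolding F[OF ultra_fadd[OF that(1,2)]]
    using that(3,4) unfolding F[OF that(1)] F[OF that(2)]
    by (simp add: fadd_le[OF N(2)] rich_fadd[OF N(2)])
  ultimately obtain p where "p \<le> ?F" "ultra p" "fadd p p = p"
    using idempotent_ultrafilter_exists[of ?F] by blast
  then show ?thesis using F by blast
qed

subsection \<open>Milliken--Taylor sums along an idempotent\<close>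

text \<open>The sum is bracketed to the right. The empty list gives the ultrafilter at
  \<open>0\<close>, so that a partial sum with nothing left to add is tested itself.\<close>

fun milliken_taylor_filter :: "'a::comm_monoid_add filter \<Rightarrow> nat list \<Rightarrow> 'a filter" where
  "milliken_taylor_filter p [] = principal {0}"
| "milliken_taylor_filter p (c # a) = fadd (filtermap (nmult c) p) (milliken_taylor_filter p a)"

lemma ultra_milliken_taylor_filter: "ultra p \<Longrightarrow> ultra (milliken_taylor_filter p a)"
  by (induction a) (auto intro: ultra_principal_singleton ultra_fadd ultra_filtermap)

lemma milliken_taylor_filter_le:
  assumes N: "filterlim (\<lambda>(x, y). x + y) N (N \<times>\<^sub>F N)" and "p \<le> N" "a \<noteq> []" "set a \<subseteq> {1..}"
  shows "milliken_taylor_filter p a \<le> N"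
  using assms(3,4)
proof (induction a)
  case (Cons c a)
  have c: "filtermap (nmult c) p \<le> N"
    using filterlim_nmult[OF N, of c] Cons.prems assms(2)
    by (auto simp: filterlim_def intro: order_trans[OF filtermap_mono])
  show ?case
  proof (cases "a = []")
    case True
    \<comment> \<open>\<open>principal {0}\<close> need not refine \<open>N\<close>, so the last
      coefficient is treated separately.\<close>
    have "fadd (filtermap (nmult c) p) (principal {0}) = filtermap (nmult c) p"
      by (simp add: filter_eq_iff eventually_fadd eventually_principal)
    with c True show ?thesis by simp
  next
    case False
    with Cons c show ?thesis by (simp add: fadd_le[OF N])
  qed
qed simp

lemma fadd_filtermap_nmult:
  "fadd (filtermap (nmult c) p) (filtermap (nmult c) q) = filtermap (nmult c) (fadd p q)"
  by (simp add: filter_eq_iff eventually_fadd eventually_filtermap nmult_add)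

text \<open>A partial sum \<open>s\<close> whose coefficients have compressed form \<open>take m a\<close> is live if it can
  be completed to an element of \<open>A\<close>, both by staying at the last coefficient used and by moving on
  to \<open>a ! m\<close>.\<close>

definition live ::
  "'a::comm_monoid_add filter \<Rightarrow> nat list \<Rightarrow> 'a set \<Rightarrow> nat \<Rightarrow> 'a \<Rightarrow> bool" where
  "live p a A m s \<longleftrightarrow>
    (\<forall>k. k = m \<or> Suc k = m \<longrightarrow> (\<forall>\<^sub>F z in milliken_taylor_filter p (drop k a). s + z \<in> A))"

text \<open>Idempotence of \<open>p\<close> gives \<open>c p + (c p + q) = c p + q\<close>. Hence
  for \<open>p\<close>-most \<open>y\<close> the enlarged sum can be completed both after moving on
  and with further terms of the same coefficient \<open>a ! k\<close>.\<close>

lemma live_step: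
  assumes "fadd p p = p" "live p a A m s" "k < length a" "k = m \<or> Suc k = m"
  shows "\<forall>\<^sub>F y in p. live p a A (Suc k) (s + nmult (a ! k) y)"
proof -
  let ?p = "filtermap (nmult (a ! k)) p" and ?q = "milliken_taylor_filter p (drop (Suc k) a)"
  have drop: "milliken_taylor_filter p (drop k a) = fadd ?p ?q"
    using Cons_nth_drop_Suc[OF assms(3)] by (metis milliken_taylor_filter.simps(2))
  have s: "\<forall>\<^sub>F z in fadd ?p ?q. s + z \<in> A"
    using assms(2,4) drop unfolding live_def by metis
  then have "\<forall>\<^sub>F y in p. \<forall>\<^sub>F z in ?q. s + nmult (a ! k) y + z \<in> A"
    by (simp add: eventually_fadd eventually_filtermap add.assoc)
  moreover have "fadd ?p (fadd ?p ?q) = fadd ?p ?q"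
    by (simp add: fadd_filtermap_nmult assms(1) flip: fadd_assoc)
  with s have "\<forall>\<^sub>F z in fadd ?p (fadd ?p ?q). s + z \<in> A"
    by simp
  then have "\<forall>\<^sub>F y in p. \<forall>\<^sub>F z in fadd ?p ?q. s + nmult (a ! k) y + z \<in> A"
    by (subst (asm) eventually_fadd) (simp add: eventually_filtermap add.assoc)
  ultimately show ?thesis
    by eventually_elim (auto simp: live_def drop)
qed

text \<open>A state records how many coefficients of \<open>a\<close> have been reached and the
  partial sum. Coefficient \<open>a ! k\<close> is used either for the first time, from
  \<open>k\<close>, or once more, from \<open>Suc k\<close>; both lead to
  \<open>Suc k\<close>.\<close>

definition transitions ::
  "nat \<Rightarrow> nat \<Rightarrow> (nat \<Rightarrow> nat \<Rightarrow> nat) \<Rightarrow> nat list \<Rightarrow> (nat \<Rightarrow> 'a::comm_monoid_add) \<Rightarrow>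
    (nat \<times> 'a) set \<Rightarrow> (nat \<times> 'a) set" where
  "transitions u v M a x G =
    {(Suc k, s + nmult (a ! k) (row_value v (M j) x)) | k s j.
      k < length a \<and> j < u \<and> ((k, s) \<in> G \<or> (Suc k, s) \<in> G)}"

lemma finite_transitions:
  assumes "finite G"
  shows "finite (transitions u v M a x G)"
proof (rule finite_subset)
  show "transitions u v M a x G \<subseteq> (\<lambda>(k, s, j). (Suc k, s + nmult (a ! k) (row_value v (M j) x))) `
      ({..<length a} \<times> snd ` G \<times> {..<u})"
    by (force simp: transitions_def image_iff)
qed (use assms in simp)

text \<open>At every stage there are finitely many states, so \<open>p\<close>-most \<open>y\<close>
  keep all their successors live at once, and richness provides a block whose row values are all
  such \<open>y\<close>. Old states are retained for rows whose coefficient on the block is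
  zero.\<close>

lemma live_sequence_exists:
  fixes u v :: "nat \<Rightarrow> nat" and M :: "nat \<Rightarrow> nat \<Rightarrow> nat \<Rightarrow> nat"
  assumes p: "fadd p p = p" "\<And>t. rich N (u t) (v t) (M t) p"
    and A: "\<forall>\<^sub>F z in milliken_taylor_filter p a. z \<in> A"
    and R: "\<And>t. \<forall>\<^sub>F x in N. x \<in> R t"
  obtains X G where "\<And>t i. i < v t \<Longrightarrow> X t i \<in> R t" "(0, 0) \<in> G 0"
    "\<And>t. G t \<union> transitions (u t) (v t) (M t) a (X t) (G t) \<subseteq> G (Suc t)"
    "\<And>t m s. (m, s) \<in> G t \<Longrightarrow> live p a A m s"
proof -
  let ?P = "\<lambda>(t :: nat) (x :: nat \<Rightarrow> 'a, G). finite G \<and> (\<forall>(m, s)\<in>G. live p a A m s) \<and> (t = 0 \<longrightarrow> (0, 0) \<in> G)"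
  let ?Q = "\<lambda>(t :: nat) (y :: nat \<Rightarrow> 'a, G) (x, G'). (\<forall>i<v t. x i \<in> R t) \<and>
    G \<union> transitions (u t) (v t) (M t) a x G \<subseteq> G'"
  have "\<exists>f. \<forall>t. ?P t (f t) \<and> ?Q t (f t) (f (Suc t))"
  proof (rule dependent_nat_choice)
    have "live p a A 0 0" using A by (simp add: live_def)
    \<comment> \<open>The block chosen at stage \<open>t\<close> is stored at stage
      \<open>Suc t\<close>; the block component at \<open>0\<close> is a dummy.\<close>
    then show "\<exists>xG. ?P 0 xG"
      by (intro exI[of _ "(undefined, {(0, 0)})"]) simp
  next
    fix xG and t :: nat assume P: "?P t xG"
    obtain y G where xG: "xG = (y, G)" by fastforce
    with P have G: "finite G" "\<And>m s. (m, s) \<in> G \<Longrightarrow> live p a A m s" by auto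
    let ?ok = "\<lambda>y. \<forall>(m, s)\<in>G. \<forall>k\<in>{k. k < length a \<and> (k = m \<or> Suc k = m)}.
      live p a A (Suc k) (s + nmult (a ! k) y)"
    have ok: "eventually ?ok p"
      unfolding case_prod_beta
    proof (intro eventually_ball_finite ballI G(1))
      fix ms k assume "ms \<in> G" "k \<in> {k. k < length a \<and> (k = fst ms \<or> Suc k = fst ms)}"
      then show "\<forall>\<^sub>F y in p. live p a A (Suc k) (snd ms + nmult (a ! k) y)"
        using live_step[OF p(1) G(2)] by (metis (mono_tags) mem_Collect_eq prod.collapse)
    qed simp
    from richD[OF p(2)[of t] ok R[of t]] obtain x where x: "\<forall>i<v t. x i \<in> R t"
      "\<forall>j<u t. ?ok (row_value (v t) (M t j) x)" by - (elim exE conjE, rule that)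
    let ?G' = "G \<union> transitions (u t) (v t) (M t) a x G"
    have live': "live p a A (Suc k) (s + nmult (a ! k) (row_value (v t) (M t j) x))"
      if "(m, s) \<in> G" "k < length a" "k = m \<or> Suc k = m" "j < u t" for m s k j
      using x(2) that by fast
    have "live p a A m s" if "(m, s) \<in> ?G'" for m s
      using that G(2) unfolding transitions_def by (auto intro: live')
    then have "?P (Suc t) (x, ?G')"
      using G(1) finite_transitions by blast
    moreover have "?Q t xG (x, ?G')"
      using x(1) xG by simp
    ultimately have "?P (Suc t) (x, ?G') \<and> ?Q t xG (x, ?G')" ..
    then show "\<exists>xG'. ?P (Suc t) xG' \<and> ?Q t xG xG'" by blast
  qed
  then obtain f where f_all: "\<forall>t. ?P t (f t) \<and> ?Q t (f t) (f (Suc t))"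
    by (rule exE)
  have f: "?P t (f t)" "?Q t (f t) (f (Suc t))" for t
    using spec[OF f_all, of t] by - (erule conjunct1, erule conjunct2)
  show thesis
  proof (rule that)
    show "(0, 0) \<in> snd (f 0)" using f(1)[of 0] by auto
  next
    fix t i assume "i < v t"
    then show "fst (f (Suc t)) i \<in> R t" using f(2)[of t] by (auto simp: case_prod_beta)
  next
    fix t
    show "snd (f t) \<union> transitions (u t) (v t) (M t) a (fst (f (Suc t))) (snd (f t)) \<subseteq> snd (f (Suc t))"
      using f(2)[of t] by (simp add: case_prod_beta)
  next
    fix t m s assume "(m, s) \<in> snd (f t)"
    then show "live p a A m s" using f(1)[of t] by (auto simp: case_prod_beta)
  qed
qed

section \<open>Reading a row of a Milliken-Taylor matrix from left to right\<close>

definition compressed_prefix :: "(nat \<Rightarrow> nat) \<Rightarrow> nat \<Rightarrow> nat list" where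
  "compressed_prefix c n = remdups_adj (filter (\<lambda>x. x \<noteq> 0) (map c [0..<n]))"

lemma remdups_adj_snoc:
  "remdups_adj (xs @ [y]) =
    (if xs \<noteq> [] \<and> last xs = y then remdups_adj xs else remdups_adj xs @ [y])"
  by (cases xs rule: rev_cases) (simp_all add: remdups_adj_append_two)

lemma compressed_prefix_Suc_cases:
  assumes "c n \<noteq> 0"
  obtains (same) k where "length (compressed_prefix c n) = Suc k" "compressed_prefix c n ! k = c n"
      "compressed_prefix c (Suc n) = compressed_prefix c n"
    | (new) "compressed_prefix c (Suc n) = compressed_prefix c n @ [c n]"
proof -
  let ?xs = "filter (\<lambda>x. x \<noteq> 0) (map c [0..<n])"
  have Suc: "compressed_prefix c (Suc n) = remdups_adj (?xs @ [c n])"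
    using assms by (simp add: compressed_prefix_def)
  show thesis
  proof (cases "?xs \<noteq> [] \<and> last ?xs = c n")
    case True
    then have ne: "compressed_prefix c n \<noteq> []" "last (compressed_prefix c n) = c n"
      unfolding compressed_prefix_def by (simp_all del: filter_map)
    have "remdups_adj (?xs @ [c n]) = remdups_adj ?xs"
      unfolding remdups_adj_snoc by (rule if_P[OF True])
    then have "compressed_prefix c (Suc n) = compressed_prefix c n"
      unfolding Suc compressed_prefix_def[of c n] .
    with ne show thesis
      by (intro same[of "length (compressed_prefix c n) - 1"]) (simp_all add: last_conv_nth)
  next
    case False
    have "remdups_adj (?xs @ [c n]) = remdups_adj ?xs @ [c n]"
      unfolding remdups_adj_snoc by (rule if_not_P[OF False])
    then have "compressed_prefix c (Suc n) = compressed_prefix c n @ [c n]"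
      unfolding Suc compressed_prefix_def[of c n] .
    then show thesis by (rule new)
  qed
qed

lemma compressed_prefix_Suc_zero:
  "c n = 0 \<Longrightarrow> compressed_prefix c (Suc n) = compressed_prefix c n"
  by (simp add: compressed_prefix_def)

text \<open>Used to see that what has been read of a row compresses to an initial segment of
  \<open>a\<close>, so that the entry just read is some \<open>a ! k\<close>.\<close>

lemma compressed_prefix_mono:
  assumes "m \<le> n"
  shows "\<exists>zs. compressed_prefix c n = compressed_prefix c m @ zs"
  using assms
proof (induction n rule: dec_induct)
  case (step n)
  show ?case
  proof (cases "c n = 0")
    case True
    then show ?thesis using step.IH by (simp add: compressed_prefix_Suc_zero)
  next
    case False
    show ?thesis
      by (cases rule: compressed_prefix_Suc_cases[of c n, OF False]) (use step.IH in auto)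
  qed
qed simp

text \<open>The row is traced through the states: a zero entry keeps the state, a repeated
  coefficient and a new one are the two kinds of transition. The length of the compressed prefix
  counts the coefficients reached.\<close>

lemma prefix_sum_in_states:
  assumes G: "(0, 0) \<in> G 0"
      "\<And>t. G t \<union> transitions (u t) (v t) (M t) a (X t) (G t) \<subseteq> G (Suc t)"
    and j: "\<And>t. j t < u t" and a: "compressed_prefix c T = a" and "n \<le> T"
  shows "(length (compressed_prefix c n),
    \<Sum>t<n. nmult (c t) (row_value (v t) (M t (j t)) (X t))) \<in> G n"
  using \<open>n \<le> T\<close>
proof (induction n)
  case 0
  then show ?case using G(1) by (simp add: compressed_prefix_def)
next
  case (Suc n)
  let ?s = "\<Sum>t<n. nmult (c t) (row_value (v t) (M t (j t)) (X t))"
  have IH: "(length (compressed_prefix c n), ?s) \<in> G n" using Suc by simp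
  have trans: "(Suc k, ?s + nmult (a ! k) (row_value (v n) (M n (j n)) (X n))) \<in> G (Suc n)"
    if "k < length a" "(k, ?s) \<in> G n \<or> (Suc k, ?s) \<in> G n" for k
    using that j[of n] G(2)[of n] unfolding transitions_def by blast
  obtain zs where zs: "a = compressed_prefix c (Suc n) @ zs"
    using compressed_prefix_mono[OF Suc.prems] a by metis
  show ?case
  proof (cases "c n = 0")
    case True
    then show ?thesis using IH G(2)[of n] by (auto simp: compressed_prefix_Suc_zero)
  next
    case False
    then show ?thesis
    proof (cases rule: compressed_prefix_Suc_cases[of c n])
      case (same k)
      then show ?thesis using trans[of k] IH zs by (simp add: nth_append)
    next
      case new
      then show ?thesis using trans[of "length (compressed_prefix c n)"] IH zs by simp
    qed
  qed
qed

theorem insertion_partition_regular: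
  fixes u v :: "nat \<Rightarrow> nat" and M :: "nat \<Rightarrow> nat \<Rightarrow> nat \<Rightarrow> nat"
  assumes N: "N \<noteq> bot" "filterlim (\<lambda>(x, y). x + y) N (N \<times>\<^sub>F N)"
    and ipr: "\<And>t. ipr_nat (u t) (v t) (M t)"
    and a: "a \<noteq> []" "set a \<subseteq> {1..}"
    and A: "finite I" "\<forall>\<^sub>F x in N. \<exists>i\<in>I. x \<in> A i"
    and R: "\<And>t. \<forall>\<^sub>F x in N. x \<in> R t"
  shows "\<exists>i\<in>I. \<forall>V. (\<forall>\<^sub>F x in N. x \<in> V) \<longrightarrow> (\<exists>X. (\<forall>t. \<forall>k<v t. X t k \<in> R t) \<and>
    (\<forall>c j T. compressed_prefix c T = a \<longrightarrow> (\<forall>t. j t < u t) \<longrightarrow>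
      (\<Sum>t<T. nmult (c t) (row_value (v t) (M t (j t)) (X t))) \<in> A i \<inter> V))"
proof -
  obtain p where p: "p \<le> N" "ultra p" "fadd p p = p" "\<And>t. rich N (u t) (v t) (M t) p"
    using rich_idempotent_exists[where N = N and u = u and v = v and M = M, OF N ipr] by blast
  let ?q = "milliken_taylor_filter p a"
  have q: "ultra ?q" "?q \<le> N"
    using ultra_milliken_taylor_filter p(2) milliken_taylor_filter_le[OF N(2) p(1) a] by auto
  \<comment> \<open>The colour \<open>i\<close> is taken from the ultrafilter alone, before any
    neighbourhood \<open>V\<close> is given.\<close>
  obtain i where i: "i \<in> I" "\<forall>\<^sub>F x in ?q. x \<in> A i"
    using ultra_eventually_ex[OF q(1) A(1) filter_leD[OF q(2) A(2)]] by blast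
  have "\<exists>X. (\<forall>t. \<forall>k<v t. X t k \<in> R t) \<and>
    (\<forall>c j T. compressed_prefix c T = a \<longrightarrow> (\<forall>t. j t < u t) \<longrightarrow>
      (\<Sum>t<T. nmult (c t) (row_value (v t) (M t (j t)) (X t))) \<in> A i \<inter> V)"
    if V: "\<forall>\<^sub>F x in N. x \<in> V" for V
  proof -
    have q_V: "\<forall>\<^sub>F x in ?q. x \<in> A i \<inter> V"
      using i(2) filter_leD[OF q(2) V] by eventually_elim simp
    obtain X G where X: "\<And>t k. k < v t \<Longrightarrow> X t k \<in> R t"
      and G: "(0, 0) \<in> G 0"
        "\<And>t. G t \<union> transitions (u t) (v t) (M t) a (X t) (G t) \<subseteq> G (Suc t)"
        "\<And>t m s. (m, s) \<in> G t \<Longrightarrow> live p a (A i \<inter> V) m s"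
      by (rule live_sequence_exists[where N = N and u = u and v = v and M = M and R = R,
          OF p(3,4) q_V R]) (rule that)
    have "(\<Sum>t<T. nmult (c t) (row_value (v t) (M t (j t)) (X t))) \<in> A i \<inter> V"
      if "compressed_prefix c T = a" "\<And>t. j t < u t" for c j T
    proof -
      \<comment> \<open>At the full length of \<open>a\<close> the remaining filter is
        \<open>principal {0}\<close>, so liveness says that the sum itself lies in
        \<open>A i \<inter> V\<close>.\<close>
      have "live p a (A i \<inter> V) (length a) (\<Sum>t<T. nmult (c t) (row_value (v t) (M t (j t)) (X t)))"
        using G(3)[OF prefix_sum_in_states[where G = G and n = T, OF G(1,2) that(2,1) order_refl]] that(1) by simp
      then show ?thesis by (simp add: live_def eventually_principal)
    qed
    with X show ?thesis by blast
  qed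
  with i(1) show ?thesis by blast
qed

subsection \<open>Transfer to the semigroup\<close>

text \<open>Adjoining a neutral element turns the sums over nonempty sets into library sums.\<close>

instantiation option :: (ab_semigroup_add) comm_monoid_add
begin

definition zero_option :: "'a option" where
  "zero_option = None"

definition plus_option :: "'a option \<Rightarrow> 'a option \<Rightarrow> 'a option" where
  "plus_option x y =
    (case x of None \<Rightarrow> y | Some a \<Rightarrow> (case y of None \<Rightarrow> x | Some b \<Rightarrow> Some (a + b)))"

instance
  by intro_classes
    (auto simp: zero_option_def plus_option_def ac_simps split: option.splits)

end

lemma Some_add: "Some a + Some b = Some (a + b)"
  by (simp add: plus_option_def)

lemma Some_sg_sum_list:
  "xs \<noteq> [] \<Longrightarrow> Some (sg_sum_list xs) = sum_list (map Some xs)"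
  by (induction xs rule: sg_sum_list.induct) (simp_all flip: Some_add)

lemma Some_sg_sum:
  assumes "finite F" "F \<noteq> {}"
  shows "Some (sg_sum f F) = (\<Sum>n\<in>F. Some (f n))"
proof -
  have "Some (sg_sum f F) = sum_list (map (\<lambda>n. Some (f n)) (sorted_list_of_set F))"
    using assms by (simp add: sg_sum_def Some_sg_sum_list o_def)
  also have "\<dots> = (\<Sum>n\<in>F. Some (f n))"
    using assms by (simp add: sum_list_distinct_conv_sum_set)
  finally show ?thesis .
qed

lemma Some_sg_mult:
  assumes "n \<noteq> 0"
  shows "Some (sg_mult n x) = nmult n (Some x)"
proof -
  have "sum_list (replicate n y) = nmult n y" for y :: "'a option"
    by (induction n) (simp_all add: nmult_Suc)
  then show ?thesis
    using assms by (simp add: sg_mult_def Some_sg_sum_list)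
qed

lemma Some_matrix_entry:
  assumes "finite {n. M k n \<noteq> 0}" "{n. M k n \<noteq> 0} \<noteq> {}"
  shows "Some (matrix_entry M x k) = (\<Sum>n | M k n \<noteq> 0. nmult (M k n) (Some (x n)))"
  unfolding matrix_entry_def Some_sg_sum[OF assms] by (rule sum.cong) (simp_all add: Some_sg_mult)

section \<open>Column blocks of insertion matrices\<close>

lemma column_block_exists:
  fixes v :: "nat \<Rightarrow> nat"
  assumes "\<And>t. v t > 0"
  shows "\<exists>t p. p < v t \<and> n = (\<Sum>s<t. v s) + p"
proof (induction n)
  case 0
  then show ?case using assms[of 0] by (intro exI[of _ 0]) simp
next
  case (Suc n)
  then obtain t p where tp: "p < v t" "n = (\<Sum>s<t. v s) + p" by blast
  show ?case
  proof (cases "Suc p < v t")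
    case True
    with tp show ?thesis by (intro exI[of _ t] exI[of _ "Suc p"]) simp
  next
    case False
    with tp assms[of "Suc t"] show ?thesis by (intro exI[of _ "Suc t"] exI[of _ 0]) simp
  qed
qed

lemma column_block_less:
  fixes v :: "nat \<Rightarrow> nat"
  assumes "t < t'" "p < v t"
  shows "(\<Sum>s<t. v s) + p < (\<Sum>s<t'. v s)"
proof -
  have "(\<Sum>s<Suc t. v s) \<le> (\<Sum>s<t'. v s)"
    using assms(1) by (intro sum_mono2) auto
  with assms(2) show ?thesis by simp
qed

lemma column_block_unique:
  fixes v :: "nat \<Rightarrow> nat"
  assumes "p < v t" "p' < v t'" "(\<Sum>s<t. v s) + p = (\<Sum>s<t'. v s) + p'"
  shows "t = t' \<and> p = p'"
proof (cases t t' rule: linorder_cases)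
  case less
  then show ?thesis using column_block_less[of t t' p v] assms by simp
next
  case greater
  then show ?thesis using column_block_less[of t' t p' v] assms by simp
qed (use assms in simp)

lemma sum_column_blocks:
  fixes f :: "nat \<Rightarrow> 'a::comm_monoid_add" and v :: "nat \<Rightarrow> nat"
  shows "(\<Sum>n<(\<Sum>s<T. v s). f n) = (\<Sum>t<T. \<Sum>p<v t. f ((\<Sum>s<t. v s) + p))"
proof (induction T)
  case (Suc T)
  have "(\<Sum>n<a + b. f n) = (\<Sum>n<a. f n) + (\<Sum>p<b. f (a + p))" for a b
    by (induction b) (simp_all add: add.assoc)
  with Suc show ?case by simp
qed simp

text \<open>With no columns every row would have the value \<open>0\<close>, which the single colour
  class \<open>{1..}\<close> excludes.\<close>

lemma ipr_nat_columns_pos: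
  assumes "ipr_nat u v M" "u > 0"
  shows "v > 0"
proof (rule ccontr)
  assume "\<not> v > 0"
  then have "v = 0" by simp
  with assms(1)[unfolded ipr_nat_def, rule_format, of 1 "\<lambda>_. {1..}"] assms(2)
  show False by auto
qed

lemma compressed_form_eq_prefix:
  assumes "{n. c n \<noteq> 0} \<subseteq> {..<T}"
  shows "compressed_prefix c T = compressed_form c"
proof -
  have "set (filter (\<lambda>n. c n \<noteq> 0) [0..<T]) = {n. c n \<noteq> 0}"
    using assms by auto
  then have "sorted_list_of_set {n. c n \<noteq> 0} = filter (\<lambda>n. c n \<noteq> 0) [0..<T]"
    by (metis sorted_list_of_set.idem_if_sorted_distinct distinct_filter distinct_upt
        sorted_wrt_filter sorted_upt)
  then show ?thesis
    by (simp add: compressed_prefix_def compressed_form_def filter_map o_def)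
qed

text \<open>Grouping the columns by blocks gathers the entries of \<open>d\<close> into
  \<open>c t\<close> times row values. Blocks from \<open>T\<close> on have coefficient zero, so
  restricting to the support of \<open>d\<close> loses nothing.\<close>

lemma concat_row_sum:
  fixes X :: "nat \<Rightarrow> nat \<Rightarrow> 'a::comm_monoid_add"
  assumes d: "is_concat_row v c b d" and v: "\<And>t. v t > 0" and c: "{t. c t \<noteq> 0} \<subseteq> {..<T}"
    and y: "\<And>t p. p < v t \<Longrightarrow> y ((\<Sum>s<t. v s) + p) = X t p"
  shows "finite {n. d n \<noteq> 0}"
    and "(\<Sum>t<T. nmult (c t) (row_value (v t) (b t) (X t))) = (\<Sum>n | d n \<noteq> 0. nmult (d n) (y n))"
proof -
  have d': "d ((\<Sum>s<t. v s) + p) = c t * b t p" if "p < v t" for t p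
    using d that by (simp add: is_concat_row_def)
  have supp: "{n. d n \<noteq> 0} \<subseteq> {..<(\<Sum>s<T. v s)}"
  proof
    fix n assume n: "n \<in> {n. d n \<noteq> 0}"
    obtain t p where tp: "p < v t" "n = (\<Sum>s<t. v s) + p"
      using column_block_exists[of v, OF v] by blast
    then have "t < T" using n d' c by auto
    then show "n \<in> {..<(\<Sum>s<T. v s)}" using column_block_less tp by simp
  qed
  then show "finite {n. d n \<noteq> 0}" by (rule finite_subset) simp
  have "(\<Sum>t<T. nmult (c t) (row_value (v t) (b t) (X t))) = (\<Sum>n<(\<Sum>s<T. v s). nmult (d n) (y n))"
    unfolding sum_column_blocks row_value_def nmult_sum
    by (intro sum.cong refl) (simp add: d' y nmult_mult)
  also have "\<dots> = (\<Sum>n | d n \<noteq> 0. nmult (d n) (y n))"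
    using supp by (intro sum.mono_neutral_right) auto
  finally show "(\<Sum>t<T. nmult (c t) (row_value (v t) (b t) (X t))) = \<dots>" .
qed

lemma nbhds_at_iff: "V \<in> nbhds_at x \<longleftrightarrow> (\<forall>\<^sub>F y in nhds x. y \<in> V)"
  by (auto simp: nbhds_at_def eventually_nhds interior_def)

theorem theorem3p8:
  fixes S :: "'a::{ab_semigroup_add, t2_space} set"
    and e :: 'a
    and U :: "nat \<Rightarrow> 'a set"
    and a :: "nat list"
    and u v :: "nat \<Rightarrow> nat"
    and B :: "nat \<Rightarrow> nat \<Rightarrow> nat \<Rightarrow> nat"
    and C D :: "nat \<Rightarrow> nat \<Rightarrow> nat"
  assumes "\<And>y::'a. continuous_on UNIV (\<lambda>x. y + x)"
    and "\<And>y::'a. continuous_on UNIV (\<lambda>x. x + y)"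
    and "closure S = UNIV"
    and "\<And>x y. x \<in> S \<Longrightarrow> y \<in> S \<Longrightarrow> x + y \<in> S"
    and "e + e = e"
    and "countable_local_base U e"
    and "F_property U e"
    and "set a \<subseteq> {1..}"
    and "compressed_list a"
    and "length a > 1"
    and "milliken_taylor_matrix a C"
    and "\<And>t. ipr_nat (u t) (v t) (B t)"
    and "insertion_matrix u v B C D"
  shows "ipr_near S e D"
proof -
  \<comment> \<open>The trace of the neighbourhood filter on \<open>S\<close>, carried into
    \<open>option\<close> so that it avoids the adjoined neutral element.\<close>
  define N where "N = filtermap Some (inf (nhds e) (principal S))"
  have ev_N: "eventually P N \<longleftrightarrow> (\<forall>\<^sub>F x in nhds e. x \<in> S \<longrightarrow> P (Some x))" for P
    by (simp add: N_def eventually_filtermap eventually_inf_principal)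
  have U_nhds: "\<forall>\<^sub>F x in nhds e. x \<in> U n" if "n \<ge> 1" for n
    using assms(6) that unfolding countable_local_base_def nbhds_at_iff[symmetric] by blast
  have U_base: "\<exists>n\<ge>1. \<forall>x\<in>U n. P x" if "eventually P (nhds e)" for P
  proof -
    have "{x. P x} \<in> nbhds_at e" using that by (simp add: nbhds_at_iff)
    then obtain W where "W \<in> U ` {1..}" "W \<subseteq> {x. P x}"
      using assms(6) unfolding countable_local_base_def by blast
    then show ?thesis by force
  qed
  have U_Suc: "U (Suc n) \<subseteq> U n" "\<And>x y. x \<in> U (Suc n) \<Longrightarrow> y \<in> U (Suc n) \<Longrightarrow> x + y \<in> U n"
    if "n \<ge> 1" for n
    using assms(7) that unfolding F_property_def by simp_all
  have U_mono: "U n \<subseteq> U m" if "1 \<le> m" "m \<le> n" for m n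
    using that(2)
  proof (induction n rule: dec_induct)
    case (step n)
    then show ?case using U_Suc(1)[of n] that(1) by auto
  qed simp
  \<comment> \<open>\<open>U\<close> is enumerated from \<open>1\<close>, hence the shift. Confining
    block \<open>t\<close> to ever smaller sets is what forces convergence to
    \<open>e\<close>.\<close>
  define R where "R t = Some ` (S \<inter> U (Suc t))" for t
  have R: "\<forall>\<^sub>F z in N. z \<in> R t" for t
    unfolding ev_N R_def using U_nhds[of "Suc t"] by (auto elim: eventually_mono)
  have N_bot: "N \<noteq> bot"
  proof
    assume "N = bot"
    then have "\<forall>\<^sub>F x in nhds e. x \<notin> S"
      using ev_N[of "\<lambda>_. False"] by simp
    then obtain W where "open W" "e \<in> W" "W \<inter> S = {}"
      unfolding eventually_nhds by blast
    then show False
      using open_Int_closure_eq_empty[of W S] assms(3) by auto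
  qed
  \<comment> \<open>Joint continuity at \<open>e\<close> comes from the sum of two elements of
    \<open>U (Suc n)\<close> lying in \<open>U n\<close>.\<close>
  have N_add: "filterlim (\<lambda>(x, y). x + y) N (N \<times>\<^sub>F N)"
    unfolding filterlim_iff
  proof (intro allI impI)
    fix P assume "eventually P N"
    then obtain n where n: "n \<ge> 1" "\<forall>x\<in>U n. x \<in> S \<longrightarrow> P (Some x)"
      using U_base unfolding ev_N by blast
    have "P (x + y)" if "x \<in> R n" "y \<in> R n" for x y
      using that n(2) U_Suc(2)[OF n(1)] assms(4) unfolding R_def by (auto simp: Some_add)
    with R show "\<forall>\<^sub>F z in N \<times>\<^sub>F N. P (case z of (x, y) \<Rightarrow> x + y)"
      unfolding eventually_prod_filter by (intro exI[of _ "\<lambda>z. z \<in> R n"]) auto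
  qed
  have row: "\<exists>i j. (\<forall>t. j t < u t) \<and> is_concat_row v (C i) (\<lambda>t. B t (j t)) (D k)" for k
    using assms(13) unfolding insertion_matrix_def by blast
  \<comment> \<open>The choice \<open>j t < u t\<close> made by any row of \<open>D\<close> shows
    that \<open>B t\<close> has a row, and therefore columns.\<close>
  then have v_pos: "v t > 0" for t
    using ipr_nat_columns_pos[OF assms(12)[of t]] by (metis gr_zeroI not_less_zero)
  have "\<forall>n. \<exists>q. snd q < v (fst q) \<and> n = (\<Sum>s<fst q. v s) + snd q"
    using column_block_exists[of v, OF v_pos] by simp
  then obtain q where q: "\<And>n. snd (q n) < v (fst (q n))" "\<And>n. n = (\<Sum>s<fst (q n). v s) + snd (q n)"
    by metis
  have q_eq: "q ((\<Sum>s<t. v s) + p) = (t, p)" if "p < v t" for t p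
  proof -
    let ?n = "(\<Sum>s<t. v s) + p"
    have "fst (q ?n) = t \<and> snd (q ?n) = p"
      by (rule column_block_unique[of _ v, OF q(1) that q(2)[symmetric]])
    then show ?thesis by (simp add: prod_eq_iff)
  qed
  show ?thesis
    unfolding ipr_near_def
  proof (intro allI impI)
    fix r :: nat and A :: "nat \<Rightarrow> 'a set"
    assume "r \<ge> 1" and S: "S = (\<Union>i\<in>{1..r}. A i)"
    have cover: "\<forall>\<^sub>F z in N. \<exists>i\<in>{1..r}. z \<in> Some ` A i"
      unfolding ev_N using S by (intro always_eventually) blast
    have "a \<noteq> []" using assms(10) by auto
    obtain i where i: "i \<in> {1..r}" and main: "\<And>W. \<forall>\<^sub>F z in N. z \<in> W \<Longrightarrow>
        \<exists>X. (\<forall>t. \<forall>p<v t. X t p \<in> R t) \<and> (\<forall>c j T. compressed_prefix c T = a \<longrightarrow> (\<forall>t. j t < u t) \<longrightarrow>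
          (\<Sum>t<T. nmult (c t) (row_value (v t) (B t (j t)) (X t))) \<in> Some ` A i \<inter> W)"
      using insertion_partition_regular[where N = N and u = u and v = v and M = B and R = R,
          OF N_bot N_add assms(12) \<open>a \<noteq> []\<close> assms(8) finite_atLeastAtMost cover R]
      by (elim bexE) (rule that, assumption, erule allE, erule mp)
    show "\<exists>i\<in>{1..r}. \<forall>V\<in>nbhds_at e. \<exists>x. (\<forall>n. x n \<in> S) \<and> x \<longlonglongrightarrow> e \<and>
        (\<forall>k. matrix_entry D x k \<in> A i \<inter> V)"
    proof (intro bexI[OF _ i] ballI)
      fix V assume "V \<in> nbhds_at e"
      then have "\<forall>\<^sub>F z in N. z \<in> Some ` V"
        unfolding ev_N nbhds_at_iff by (auto elim: eventually_mono)
      from main[OF this] obtain X where X: "\<And>t p. p < v t \<Longrightarrow> X t p \<in> R t"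
        and X_sum: "\<And>c j T. compressed_prefix c T = a \<Longrightarrow> (\<And>t. j t < u t) \<Longrightarrow>
          (\<Sum>t<T. nmult (c t) (row_value (v t) (B t (j t)) (X t))) \<in> Some ` A i \<inter> Some ` V"
        by auto
      define x where "x n = the (X (fst (q n)) (snd (q n)))" for n
      have x: "Some (x n) = X (fst (q n)) (snd (q n))" "x n \<in> S" "x n \<in> U (Suc (fst (q n)))" for n
        using X[OF q(1)[of n]] by (auto simp: x_def R_def)
      have "x \<longlonglongrightarrow> e"
        unfolding filterlim_iff
      proof (intro allI impI)
        fix P assume "eventually P (nhds e)"
        then obtain m where m: "m \<ge> 1" "\<forall>y\<in>U m. P y" using U_base by blast
        have "P (x n)" if "n \<ge> (\<Sum>s<m. v s)" for n
        proof -
          have "\<not> fst (q n) < m"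
            using column_block_less[of "fst (q n)" m "snd (q n)" v] q(1)[of n] q(2)[of n] that by linarith
          then have "U (Suc (fst (q n))) \<subseteq> U m" using m(1) by (intro U_mono) auto
          then show ?thesis using x(3)[of n] m(2) by auto
        qed
        then show "\<forall>\<^sub>F n in sequentially. P (x n)"
          by (auto simp: eventually_sequentially)
      qed
      moreover have "matrix_entry D x k \<in> A i \<inter> V" for k
      proof -
        obtain l j where j: "\<And>t. j t < u t" and d: "is_concat_row v (C l) (\<lambda>t. B t (j t)) (D k)"
          using row[of k] by blast
        have c: "finite {n. C l n \<noteq> 0}" "compressed_form (C l) = a"
          using assms(11) unfolding milliken_taylor_matrix_def by blast+
        then obtain T where T: "{n. C l n \<noteq> 0} \<subseteq> {..<T}"
          using finite_nat_iff_bounded by blast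
        have "Some (x ((\<Sum>s<t. v s) + p)) = X t p" if "p < v t" for t p
          using x(1) q_eq[OF that] by simp
        then have D: "finite {n. D k n \<noteq> 0}"
          "(\<Sum>t<T. nmult (C l t) (row_value (v t) (B t (j t)) (X t))) =
            (\<Sum>n | D k n \<noteq> 0. nmult (D k n) (Some (x n)))"
          using concat_row_sum[where v = v and X = X and y = "\<lambda>n. Some (x n)", OF d v_pos T]
          by blast+
        have sum: "(\<Sum>n | D k n \<noteq> 0. nmult (D k n) (Some (x n))) \<in> Some ` A i \<inter> Some ` V"
          using X_sum[OF _ j, of "C l" T] compressed_form_eq_prefix[OF T] c(2) D(2) by simp
        \<comment> \<open>An empty sum would be the adjoined \<open>0\<close>, which is not of the
          form \<open>Some\<close>. So the row is nonzero and its matrix entry is a genuine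
          sum.\<close>
        then have "{n. D k n \<noteq> 0} \<noteq> {}"
          by (metis (no_types, lifting) IntE image_iff option.distinct(1) sum.empty zero_option_def)
        from sum[folded Some_matrix_entry[where M = D and k = k, OF D(1) this]] show ?thesis
          by auto
      qed
      ultimately show "\<exists>x. (\<forall>n. x n \<in> S) \<and> x \<longlonglongrightarrow> e \<and> (\<forall>k. matrix_entry D x k \<in> A i \<inter> V)"
        using x(2) by blast
    qed
  qed
qed

end
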